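(* Let $N\ge 2$ and $n,m\ge 1$. Let $\{\mathcal{G}_k : k\in\mathcal{P}\}$, $\mathcal{P}=\{1,\ldots,Q\}$, be a finite family of undirected weighted graphs on the node set $\{1,\ldots,N\}$ with weights $a^k_{ij}=a^k_{ji}\ge 0$, $a^k_{ii}=0$. Let $\sigma:[0,\infty)\to\mathcal{P}$ be a right-continuous, piecewise constant switching signal whose consecutive switching instants are separated by at least a dwell time $T_{\min}>0$. Assume: (i) there exists $T>0$ such that for every $t_0\ge 0$ the union graph $\bigcup_{t\in[t_0,t_0+T)}\mathcal{G}_{\sigma(t)}$ contains a directed spanning tree (equivalently, since the graphs are undirected, is connected); (ii) $A\in\mathbb{R}^{n\times n}$, $B\in\mathbb{R}^{n\times m}$ and the pair $(A,B)$ is stabilizable; (iii) there exists a symmetric positive definite matrix $P\in\mathbb{R}^{n\times n}$ such that $A^{\mathrm{T}}P+PA\le 0$ and the pair $(B^{\mathrm{T}}P,A)$ is observable. Let $\phi>0$ and $K=B^{\mathrm{T}}P$, and consider $$\dot{x}_i=Ax_i+\phi BK\sum_{j=1}^N a_{ij}^{\sigma(t)}(x_j-x_i),\qquad i=1,\ldots,N,\ x_i\in\mathbb{R}^n.$$ Then synchronization is achieved: for every initial condition, $\lim_{t\to\infty}\|x_i(t)-x_j(t)\|=0$ for all $i,j\in\{1,\ldots,N\}$.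
   Context: For a weighted digraph with weights $a_{ij}\ge0$, $a_{ij}>0$ means that $(j,i)$ is an edge (information flows from $j$ to $i$). A directed path is a sequence of edges $(i_1,i_2),(i_2,i_3),\ldots,(i_{q-1},i_q)$. A digraph contains a directed spanning tree if some node has a directed path to every other node. The union of a family of graphs on the same node set has as edge set the union of their edge sets. An undirected graph is one with symmetric weights $a_{ij}=a_{ji}$; each undirected edge counts as edges in both directions. *)

theory Defs
  imports "HOL-Analysis.Analysis"
begin

text \<open>A real square matrix is Hurwitz if every (complex) eigenvalue has negative real part.\<close>
definition hurwitz :: "real^'n^'n \<Rightarrow> bool" where
  "hurwitz M \<longleftrightarrow>
     (\<forall>(l::complex) (v::complex^'n). v \<noteq> 0 \<and> (\<chi> i j. complex_of_real (M$i$j)) *v v = l *s v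
        \<longrightarrow> Re l < 0)"

text \<open>(A,B) stabilizable: some state feedback u = F x makes A + B F Hurwitz.\<close>
definition stabilizable :: "real^'n^'n \<Rightarrow> real^'m^'n \<Rightarrow> bool" where
  "stabilizable A B \<longleftrightarrow> (\<exists>F::real^'n^'m. hurwitz (A + B ** F))"

text \<open>(C,A) observable (Kalman rank condition): the observability matrix
  [C; C A; ...; C A^(n-1)] has trivial kernel, i.e. full column rank n.\<close>
definition observable :: "real^'n^'p \<Rightarrow> real^'n^'n \<Rightarrow> bool" where
  "observable C A \<longleftrightarrow>
     (\<forall>x::real^'n. (\<forall>k<CARD('n). C *v ((((*v) A) ^^ k) x) = 0) \<longrightarrow> x = 0)"

definition pos_def :: "real^'n^'n \<Rightarrow> bool" where
  "pos_def P \<longleftrightarrow> (\<forall>x. x \<noteq> 0 \<longrightarrow> x \<bullet> (P *v x) > 0)"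

definition neg_semidef :: "real^'n^'n \<Rightarrow> bool" where
  "neg_semidef M \<longleftrightarrow> (\<forall>x. x \<bullet> (M *v x) \<le> 0)"

text \<open>Right-continuous piecewise constant switching signal with dwell time Tmin:
  a sequence of instants s 0 = 0 < s 1 < ... with gaps at least Tmin, sig constant
  on each [s k, s (k+1)), values in {1..Q}.\<close>
definition switching_signal :: "(real \<Rightarrow> nat) \<Rightarrow> nat \<Rightarrow> real \<Rightarrow> bool" where
  "switching_signal sig Q Tmin \<longleftrightarrow>
     (\<forall>t\<ge>0. sig t \<in> {1..Q}) \<and>
     (\<exists>s::nat \<Rightarrow> real. s 0 = 0 \<and> (\<forall>k. s (Suc k) - s k \<ge> Tmin) \<and>
        (\<forall>k t. s k \<le> t \<and> t < s (Suc k) \<longrightarrow> sig t = sig (s k)))"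

text \<open>Edge set of the union graph over a time interval: (j,i) is an edge iff a_ij > 0
  for the active graph at some time in the interval.\<close>
definition union_edges ::
  "(nat \<Rightarrow> 'v \<Rightarrow> 'v \<Rightarrow> real) \<Rightarrow> (real \<Rightarrow> nat) \<Rightarrow> real set \<Rightarrow> ('v \<times> 'v) set" where
  "union_edges a sig I = {(j, i). \<exists>t\<in>I. a (sig t) i j > 0}"

text \<open>A digraph on the (finite) node type 'v contains a directed spanning tree iff
  some node has a directed path to every other node.\<close>
definition has_spanning_tree :: "('v \<times> 'v) set \<Rightarrow> bool" where
  "has_spanning_tree E \<longleftrightarrow> (\<exists>r. \<forall>i. i \<noteq> r \<longrightarrow> (r, i) \<in> E\<^sup>+)"

end

(*
  The function V = sum_{i,j} (x_i - x_j)' P (x_i - x_j) is nonincreasing along solutions, with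
  V' <= - phi * sum_{i,j} a_ij |K (x_i - x_j)|^2 where K = B' P.  Since V converges and the dwell
  time keeps an active edge active on windows of fixed length, |K (x_i - x_j)| -> 0 along active
  edges, so the coupling inputs vanish asymptotically.  On an edge that stays active over a window,
  K A^(k+1) (x_i - x_j) is the derivative of K A^k (x_i - x_j) up to vanishing terms, hence by
  induction every K A^k (x_i - x_j) tends to 0 there, and observability of (K, A) gives
  x_i - x_j -> 0 along such edges.  A Gronwall estimate carries this over the bounded time span
  T + Tmin, and chaining along a spanning tree of the union graph on [t, t + T) synchronizes
  every pair of agents.
*)

theory Submission
  imports Defs
begin

section \<open>Mean value inequalities for right derivatives\<close>

lemma right_derivative_neg_imp_le:
  fixes f :: "real \<Rightarrow> real"
  assumes ab: "a \<le> b" and cont: "continuous_on {a..b} f"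
    and der: "\<And>x. x \<in> {a..<b} \<Longrightarrow> (f has_real_derivative f' x) (at x within {x..})"
    and neg: "\<And>x. x \<in> {a..<b} \<Longrightarrow> f' x < 0"
  shows "f b \<le> f a"
proof -
  let ?Z = "{a..b} \<inter> f -` {..f a}"
  have "closed ?Z" by (rule continuous_closed_preimage[OF cont]) auto
  then have "compact ?Z" by (simp add: compact_eq_bounded_closed bounded_Int)
  moreover have "a \<in> ?Z" using ab by auto
  ultimately obtain c where cZ: "c \<in> ?Z" and cmax: "\<And>y. y \<in> ?Z \<Longrightarrow> y \<le> c"
    using compact_attains_sup by (metis empty_iff)
  show ?thesis
  proof (cases "c = b")
    case True
    then show ?thesis using cZ by auto
  next
    case False
    then have c: "c \<in> {a..<b}" using cZ by auto
    have "((\<lambda>y. (f y - f c) / (y - c)) \<longlongrightarrow> f' c) (at_right c)"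
      using der[OF c] by (simp add: has_field_derivative_iff at_within_Ici_at_right)
    then have "eventually (\<lambda>y. (f y - f c) / (y - c) < 0) (at_right c)"
      using neg[OF c] by (simp add: order_tendstoD(2))
    then obtain e where e: "e > c" and slope: "\<And>y. c < y \<Longrightarrow> y < e \<Longrightarrow> (f y - f c) / (y - c) < 0"
      by (auto simp: eventually_at_right_field)
    define y where "y = min ((c + e) / 2) b"
    have y: "c < y" "y < e" "y \<le> b" using e c by (auto simp: y_def min_def)
    then have "f y < f c" using slope[of y] by (simp add: divide_less_0_iff)
    then have "y \<in> ?Z" using cZ y by auto
    then show ?thesis using cmax y by fastforce
  qed
qed

lemma right_derivative_le_imp_diff_le:
  fixes f :: "real \<Rightarrow> real"
  assumes ab: "a \<le> b" and cont: "continuous_on {a..b} f"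
    and der: "\<And>x. x \<in> {a..<b} \<Longrightarrow> (f has_real_derivative f' x) (at x within {x..})"
    and le: "\<And>x. x \<in> {a..<b} \<Longrightarrow> f' x \<le> M"
  shows "f b - f a \<le> M * (b - a)"
proof (rule field_le_epsilon)
  fix e :: real
  assume e: "e > 0"
  define e' where "e' = e / (b - a + 1)"
  have e': "e' > 0" using e ab by (simp add: e'_def)
  have "e' * (b - a) = e * ((b - a) / (b - a + 1))" by (simp add: e'_def)
  also have "\<dots> \<le> e" using e ab by (intro mult_left_le) auto
  finally have e'_le: "e' * (b - a) \<le> e" .
  let ?g = "\<lambda>x. f x - (M + e') * (x - a)"
  have "?g b \<le> ?g a"
  proof (rule right_derivative_neg_imp_le[OF ab, where f' = "\<lambda>x. f' x - (M + e')"])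
    show "continuous_on {a..b} ?g" by (intro continuous_intros cont)
    fix x
    assume x: "x \<in> {a..<b}"
    show "(?g has_real_derivative f' x - (M + e')) (at x within {x..})"
      using der[OF x] by (auto intro!: derivative_eq_intros)
    show "f' x - (M + e') < 0" using le[OF x] e' by simp
  qed
  then show "f b - f a \<le> M * (b - a) + e"
    using e'_le by (simp add: distrib_right)
qed

lemma has_real_derivative_inner:
  fixes f g :: "real \<Rightarrow> 'a::real_inner"
  assumes "(f has_vector_derivative f') (at t within S)" "(g has_vector_derivative g') (at t within S)"
  shows "((\<lambda>t. inner (f t) (g t)) has_real_derivative inner f' (g t) + inner (f t) g') (at t within S)"
proof -
  have "((\<lambda>t. inner (f t) (g t)) has_derivative
      (\<lambda>h. inner (f t) (h *\<^sub>R g') + inner (h *\<^sub>R f') (g t))) (at t within S)"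
    using assms unfolding has_vector_derivative_def by (intro has_derivative_inner) auto
  moreover have "(\<lambda>h. inner (f t) (h *\<^sub>R g') + inner (h *\<^sub>R f') (g t)) = (*) (inner f' (g t) + inner (f t) g')"
    by (auto simp: fun_eq_iff algebra_simps)
  ultimately show ?thesis by (simp add: has_field_derivative_def)
qed

lemma right_vector_derivative_bound_imp_norm_le:
  fixes f :: "real \<Rightarrow> 'a::real_inner"
  assumes ab: "a \<le> b" and cont: "continuous_on {a..b} f"
    and der: "\<And>x. x \<in> {a..<b} \<Longrightarrow> (f has_vector_derivative f' x) (at x within {x..})"
    and le: "\<And>x. x \<in> {a..<b} \<Longrightarrow> norm (f' x) \<le> M"
  shows "norm (f b - f a) \<le> M * (b - a)"
proof (cases "a = b")
  case False
  then have "a \<in> {a..<b}" using ab by auto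
  then have M: "M \<ge> 0" using le norm_ge_zero order_trans by blast
  define u where "u = f b - f a"
  have "inner u (f b) - inner u (f a) \<le> (norm u * M) * (b - a)"
  proof (rule right_derivative_le_imp_diff_le[OF ab, where f' = "\<lambda>x. inner u (f' x)"])
    show "continuous_on {a..b} (\<lambda>x. inner u (f x))" by (intro continuous_intros cont)
    fix x
    assume x: "x \<in> {a..<b}"
    show "((\<lambda>x. inner u (f x)) has_real_derivative inner u (f' x)) (at x within {x..})"
      using has_real_derivative_inner[OF has_vector_derivative_const der[OF x]] by simp
    have "inner u (f' x) \<le> norm u * norm (f' x)" by (rule norm_cauchy_schwarz)
    also have "\<dots> \<le> norm u * M" using le[OF x] by (simp add: mult_left_mono)
    finally show "inner u (f' x) \<le> norm u * M" .
  qed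
  moreover have "inner u (f b) - inner u (f a) = norm u * norm u"
    by (simp add: u_def flip: inner_diff_right power2_eq_square power2_norm_eq_inner)
  ultimately have "norm u * norm u \<le> norm u * (M * (b - a))" by (simp only: mult.assoc)
  moreover have "0 \<le> M * (b - a)" using M ab by simp
  ultimately show ?thesis
    unfolding u_def[symmetric] by (cases "u = 0") (auto simp: mult_le_cancel_left_pos)
qed simp

lemma right_vector_derivative_near_imp_norm_le:
  fixes g :: "real \<Rightarrow> 'a::real_inner"
  assumes \<delta>: "\<delta> \<ge> 0" and cont: "continuous_on {t..t + \<delta>} g"
    and der: "\<And>s. s \<in> {t..<t + \<delta>} \<Longrightarrow> (g has_vector_derivative g' s) (at s within {s..})"
    and near: "\<And>s. s \<in> {t..<t + \<delta>} \<Longrightarrow> norm (g' s - c) \<le> \<rho>"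
  shows "\<delta> * norm c \<le> norm (g t) + norm (g (t + \<delta>)) + \<rho> * \<delta>"
proof -
  let ?f = "\<lambda>s. g s - (s - t) *\<^sub>R c"
  have "norm (?f (t + \<delta>) - ?f t) \<le> \<rho> * ((t + \<delta>) - t)"
  proof (rule right_vector_derivative_bound_imp_norm_le[where f' = "\<lambda>s. g' s - c"])
    show "continuous_on {t..t + \<delta>} ?f" by (intro continuous_intros cont)
    fix s
    assume s: "s \<in> {t..<t + \<delta>}"
    have "((\<lambda>s. (s - t) *\<^sub>R c) has_vector_derivative (s - t) *\<^sub>R 0 + (1 - 0) *\<^sub>R c) (at s within {s..})"
      by (intro has_vector_derivative_scaleR has_vector_derivative_const DERIV_diff DERIV_ident DERIV_const)
    then show "(?f has_vector_derivative g' s - c) (at s within {s..})"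
      using has_vector_derivative_diff[OF der[OF s]] by simp
  qed (use \<delta> near in auto)
  then have drift: "norm (g (t + \<delta>) - \<delta> *\<^sub>R c - g t) \<le> \<rho> * \<delta>" by simp
  have "\<delta> *\<^sub>R c = (g (t + \<delta>) - g t) - (g (t + \<delta>) - \<delta> *\<^sub>R c - g t)"
    by (simp add: algebra_simps)
  then have "norm (\<delta> *\<^sub>R c) \<le> norm (g (t + \<delta>) - g t) + norm (g (t + \<delta>) - \<delta> *\<^sub>R c - g t)"
    by (metis norm_triangle_ineq4)
  also have "\<dots> \<le> norm (g t) + norm (g (t + \<delta>)) + \<rho> * \<delta>"
    using drift norm_triangle_ineq4[of "g (t + \<delta>)" "g t"] by linarith
  finally show ?thesis using \<delta> by simp
qed

lemma right_derivative_le_linear_imp_exp_bound: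
  fixes G :: "real \<Rightarrow> real"
  assumes ab: "a \<le> b" and cont: "continuous_on {a..b} G"
    and der: "\<And>s. s \<in> {a..<b} \<Longrightarrow> (G has_real_derivative G' s) (at s within {s..})"
    and le: "\<And>s. s \<in> {a..<b} \<Longrightarrow> G' s \<le> c * G s"
  shows "G b \<le> exp (c * (b - a)) * G a"
proof -
  let ?H = "\<lambda>s. exp (- c * s) * G s"
  have "?H b - ?H a \<le> 0 * (b - a)"
  proof (rule right_derivative_le_imp_diff_le[OF ab, where f' = "\<lambda>s. exp (- c * s) * (G' s - c * G s)"])
    show "continuous_on {a..b} ?H" by (intro continuous_intros cont)
    fix s
    assume s: "s \<in> {a..<b}"
    show "(?H has_real_derivative exp (- c * s) * (G' s - c * G s)) (at s within {s..})"
      using der[OF s] by (auto intro!: derivative_eq_intros simp: algebra_simps)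
    show "exp (- c * s) * (G' s - c * G s) \<le> 0"
      using le[OF s] by (simp add: mult_nonneg_nonpos)
  qed
  then have "exp (c * b) * ?H b \<le> exp (c * b) * ?H a" by simp
  then show ?thesis
    by (simp add: mult.assoc[symmetric] flip: exp_add) (simp add: algebra_simps)
qed

lemma right_derivative_ge_linear_imp_exp_bound:
  fixes G :: "real \<Rightarrow> real"
  assumes ab: "a \<le> b" and cont: "continuous_on {a..b} G"
    and der: "\<And>s. s \<in> {a..<b} \<Longrightarrow> (G has_real_derivative G' s) (at s within {s..})"
    and ge: "\<And>s. s \<in> {a..<b} \<Longrightarrow> - c * G s \<le> G' s"
  shows "G a \<le> exp (c * (b - a)) * G b"
proof -
  let ?H = "\<lambda>s. - (exp (c * s) * G s)"
  have "?H b - ?H a \<le> 0 * (b - a)"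
  proof (rule right_derivative_le_imp_diff_le[OF ab, where f' = "\<lambda>s. - (exp (c * s) * (G' s + c * G s))"])
    show "continuous_on {a..b} ?H" by (intro continuous_intros cont)
    fix s
    assume s: "s \<in> {a..<b}"
    show "(?H has_real_derivative - (exp (c * s) * (G' s + c * G s))) (at s within {s..})"
      using der[OF s] by (auto intro!: derivative_eq_intros simp: algebra_simps)
    show "- (exp (c * s) * (G' s + c * G s)) \<le> 0"
      using ge[OF s] by simp
  qed
  then have "exp (- c * a) * (exp (c * a) * G a) \<le> exp (- c * a) * (exp (c * b) * G b)" by simp
  then show ?thesis
    by (simp add: mult.assoc[symmetric] flip: exp_add) (simp add: algebra_simps)
qed

lemma right_derivative_abs_le_linear_imp_exp_bound:
  fixes G :: "real \<Rightarrow> real"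
  assumes cont: "continuous_on {t0..} G"
    and der: "\<And>s. s \<ge> t0 \<Longrightarrow> (G has_real_derivative G' s) (at s within {s..})"
    and rate: "\<And>s. s \<ge> t0 \<Longrightarrow> \<bar>G' s\<bar> \<le> c * G s"
    and t: "t \<ge> t0" and \<tau>: "\<tau> \<ge> t0"
  shows "G \<tau> \<le> exp (c * \<bar>\<tau> - t\<bar>) * G t"
proof -
  have le: "G' s \<le> c * G s" and ge: "- c * G s \<le> G' s" if "s \<ge> t0" for s
    using rate[OF that] by (auto simp: abs_le_iff)
  show ?thesis
  proof (cases "t \<le> \<tau>")
    case True
    have "G \<tau> \<le> exp (c * (\<tau> - t)) * G t"
      using le t by (intro right_derivative_le_linear_imp_exp_bound[OF True continuous_on_subset[OF cont] der])
        auto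
    then show ?thesis using True by simp
  next
    case False
    have "G \<tau> \<le> exp (c * (t - \<tau>)) * G t"
      using ge \<tau> False by (intro right_derivative_ge_linear_imp_exp_bound[OF _ continuous_on_subset[OF cont] der])
        auto
    then show ?thesis using False by simp
  qed
qed

section \<open>Norms, quadratic forms and graphs\<close>

lemma homogeneous_pos_lower_bound:
  fixes g :: "'a::euclidean_space \<Rightarrow> real"
  assumes cont: "continuous_on UNIV g" and pos: "\<And>v. v \<noteq> 0 \<Longrightarrow> g v > 0"
    and hom: "\<And>r v. r > 0 \<Longrightarrow> g (r *\<^sub>R v) = r ^ p * g v" and g0: "g 0 \<ge> 0" and p: "p > 0"
  shows "\<exists>c>0. \<forall>v. c * norm v ^ p \<le> g v"
proof -
  have "sphere (0::'a) 1 \<noteq> {}" by simp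
  then obtain v0 where v0: "v0 \<in> sphere 0 1" and vmin: "\<And>y. y \<in> sphere 0 1 \<Longrightarrow> g v0 \<le> g y"
    using continuous_attains_inf[OF compact_sphere _ continuous_on_subset[OF cont]] by blast
  have "v0 \<noteq> 0" using v0 by auto
  then have "g v0 > 0" by (rule pos)
  moreover have "g v0 * norm v ^ p \<le> g v" for v
  proof (cases "v = 0")
    case True
    then show ?thesis using g0 p by (simp add: zero_power)
  next
    case False
    then have nv: "norm v > 0" by simp
    have "(1 / norm v) *\<^sub>R v \<in> sphere 0 1" using False by (simp add: norm_divide)
    then have "g v0 \<le> g ((1 / norm v) *\<^sub>R v)" by (rule vmin)
    also have "\<dots> = (1 / norm v) ^ p * g v" using nv by (intro hom) simp
    finally have "g v0 * norm v ^ p \<le> (1 / norm v) ^ p * g v * norm v ^ p"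
      using nv by (intro mult_right_mono) auto
    also have "\<dots> = g v" using nv by (simp add: power_one_over field_simps)
    finally show ?thesis .
  qed
  ultimately show ?thesis by blast
qed

lemma pos_def_quadratic_lower_bound:
  assumes "pos_def (P::real^'n^'n)"
  shows "\<exists>c>0. \<forall>v. c * norm v ^ 2 \<le> inner v (P *v v)"
proof (rule homogeneous_pos_lower_bound)
  show "continuous_on UNIV (\<lambda>v. inner v (P *v v))" by (intro continuous_intros)
  show "\<And>v. v \<noteq> 0 \<Longrightarrow> inner v (P *v v) > 0" using assms unfolding pos_def_def by auto
  show "\<And>r v. inner (r *\<^sub>R v) (P *v (r *\<^sub>R v)) = r ^ 2 * inner v (P *v v)"
    by (simp add: matrix_vector_mult_scaleR power2_eq_square)
qed auto

lemma pos_def_quadratic_nonneg: "pos_def P \<Longrightarrow> 0 \<le> inner v (P *v v)"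
  unfolding pos_def_def by (cases "v = 0") (auto intro: less_imp_le)

lemma matrix_vector_mult_norm_bound: "\<exists>C>0. \<forall>z. norm ((M::real^'a^'b) *v z) \<le> C * norm z"
  using bounded_linear.pos_bounded[OF matrix_vector_mul_bounded_linear[of M]]
  by (auto simp: mult.commute)

lemma sum_pairs_inner_laplacian:
  fixes y :: "'v::finite \<Rightarrow> 'a::real_inner" and w :: "'v \<Rightarrow> 'v \<Rightarrow> real"
  assumes sym: "\<And>i k. w i k = w k i"
  defines "V \<equiv> \<lambda>i. \<Sum>k\<in>UNIV. w i k *\<^sub>R (y k - y i)"
  shows "(\<Sum>i\<in>UNIV. \<Sum>j\<in>UNIV. inner (V i - V j) (y i - y j))
         = - real CARD('v) * (\<Sum>i\<in>UNIV. \<Sum>k\<in>UNIV. w i k * (norm (y i - y k))\<^sup>2)"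
proof -
  have sum_V: "(\<Sum>i\<in>UNIV. V i) = 0"
  proof -
    have "(\<Sum>i\<in>UNIV. V i) = (\<Sum>i\<in>UNIV. \<Sum>k\<in>UNIV. w i k *\<^sub>R y k) - (\<Sum>i\<in>UNIV. \<Sum>k\<in>UNIV. w i k *\<^sub>R y i)"
      by (simp add: V_def scaleR_diff_right sum_subtractf)
    also have "(\<Sum>i\<in>UNIV. \<Sum>k\<in>UNIV. w i k *\<^sub>R y k) = (\<Sum>i\<in>UNIV. \<Sum>k\<in>UNIV. w i k *\<^sub>R y i)"
      by (subst sum.swap) (simp add: sym)
    finally show ?thesis by simp
  qed
  have "(\<Sum>i\<in>UNIV. \<Sum>j\<in>UNIV. inner (V i - V j) (y i - y j))
      = (\<Sum>i\<in>UNIV. \<Sum>j\<in>UNIV. inner (V i) (y i) + inner (V j) (y j) - inner (V i) (y j) - inner (V j) (y i))"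
    by (simp add: inner_diff_left inner_diff_right algebra_simps)
  also have "\<dots> = 2 * real CARD('v) * (\<Sum>i\<in>UNIV. inner (V i) (y i)) - 2 * inner (\<Sum>i\<in>UNIV. V i) (\<Sum>i\<in>UNIV. y i)"
    by (simp add: sum_subtractf sum.distrib inner_sum_left inner_sum_right sum_distrib_left algebra_simps)
       (subst sum.swap, simp add: sum_distrib_left)
  also have "\<dots> = 2 * real CARD('v) * (\<Sum>i\<in>UNIV. inner (V i) (y i))" using sum_V by simp
  also have "(\<Sum>i\<in>UNIV. inner (V i) (y i)) = - (1/2) * (\<Sum>i\<in>UNIV. \<Sum>k\<in>UNIV. w i k * (norm (y i - y k))\<^sup>2)"
  proof -
    have expand: "(\<Sum>i\<in>UNIV. inner (V i) (y i)) = (\<Sum>i\<in>UNIV. \<Sum>k\<in>UNIV. w i k * inner (y k - y i) (y i))"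
      by (simp add: V_def inner_sum_left)
    have swap: "(\<Sum>i\<in>UNIV. \<Sum>k\<in>UNIV. w i k * inner (y k - y i) (y i)) = (\<Sum>i\<in>UNIV. \<Sum>k\<in>UNIV. w i k * inner (y i - y k) (y k))"
      by (subst sum.swap) (simp add: sym)
    have "2 * (\<Sum>i\<in>UNIV. inner (V i) (y i)) = (\<Sum>i\<in>UNIV. \<Sum>k\<in>UNIV. w i k * (inner (y k - y i) (y i) + inner (y i - y k) (y k)))"
      using expand swap by (simp add: distrib_left sum.distrib)
    also have "\<dots> = (\<Sum>i\<in>UNIV. \<Sum>k\<in>UNIV. - (w i k * (norm (y i - y k))\<^sup>2))"
      by (intro sum.cong refl) (simp add: power2_norm_eq_inner inner_diff_left inner_diff_right algebra_simps inner_commute)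
    finally show ?thesis by (simp add: sum_negf)
  qed
  finally show ?thesis by simp
qed

lemma relpow_norm_diff_le:
  fixes X :: "'v \<Rightarrow> 'a::real_normed_vector"
  assumes step: "\<And>u v. (u, v) \<in> R \<Longrightarrow> norm (X u - X v) \<le> \<beta>"
  shows "(p, q) \<in> R ^^ n \<Longrightarrow> norm (X p - X q) \<le> real n * \<beta>"
proof (induction n arbitrary: q)
  case (Suc n)
  then obtain y where y: "(p, y) \<in> R ^^ n" "(y, q) \<in> R" by auto
  have "norm (X p - X q) \<le> norm (X p - X y) + norm (X y - X q)"
    using norm_triangle_ineq[of "X p - X y" "X y - X q"] by simp
  also have "\<dots> \<le> real n * \<beta> + \<beta>" using Suc.IH[OF y(1)] step[OF y(2)] by linarith
  finally show ?case by (simp add: algebra_simps)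
qed simp

lemma has_spanning_tree_norm_diff_le:
  fixes X :: "'v::finite \<Rightarrow> 'a::real_normed_vector"
  assumes tree: "has_spanning_tree E" and step: "\<And>u v. (u, v) \<in> E \<Longrightarrow> norm (X u - X v) \<le> \<beta>"
    and \<beta>: "\<beta> \<ge> 0"
  shows "norm (X p - X q) \<le> 2 * real CARD('v \<times> 'v) * \<beta>"
proof -
  obtain r where r: "\<And>i. i \<noteq> r \<Longrightarrow> (r, i) \<in> E\<^sup>+"
    using tree unfolding has_spanning_tree_def by blast
  have from_root: "norm (X r - X i) \<le> real CARD('v \<times> 'v) * \<beta>" for i
  proof (cases "i = r")
    case False
    then obtain n where n: "n \<le> card E" "(r, i) \<in> E ^^ n"
      using r[OF False] unfolding trancl_finite_eq_relpow[OF finite] by blast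
    have "card E \<le> CARD('v \<times> 'v)" by (rule card_mono) auto
    then have "real n * \<beta> \<le> real CARD('v \<times> 'v) * \<beta>"
      using n(1) \<beta> by (intro mult_right_mono) (simp_all only: of_nat_le_iff)
    then show ?thesis using relpow_norm_diff_le[where X = X, OF step n(2)] by linarith
  qed (use \<beta> in simp)
  have "norm (X p - X q) \<le> norm (X r - X p) + norm (X r - X q)"
    using norm_triangle_ineq[of "X p - X r" "X r - X q"] by (simp add: norm_minus_commute)
  then show ?thesis using from_root[of p] from_root[of q] by linarith
qed

primrec matpow :: "'a::semiring_1^'n^'n \<Rightarrow> nat \<Rightarrow> 'a^'n^'n" where
  "matpow M 0 = mat 1"
| "matpow M (Suc k) = matpow M k ** M"

lemma funpow_matrix_vector_mult: "(((*v) M) ^^ k) z = matpow M k *v z"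
  by (induction k arbitrary: z) (simp_all add: funpow_Suc_right matrix_vector_mul_assoc del: funpow.simps)

section \<open>Switching signals with dwell time\<close>

lemma switching_signal_dwell_window:
  assumes sw: "switching_signal sig Q Tmin" and t: "t \<ge> 0" and h: "0 \<le> h" "h < Tmin"
  obtains t' where "t - h \<le> t'" "t' \<le> t" "\<And>s. s \<in> {t'..t' + h} \<Longrightarrow> sig s = sig t"
proof -
  obtain \<tau> where \<tau>0: "\<tau> 0 = 0" and gap: "\<And>k. \<tau> (Suc k) - \<tau> k \<ge> Tmin"
    and const: "\<And>k s. \<tau> k \<le> s \<Longrightarrow> s < \<tau> (Suc k) \<Longrightarrow> sig s = sig (\<tau> k)"
    using sw unfolding switching_signal_def by blast
  have Tmin: "Tmin > 0" using h by linarith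
  have \<tau>_ge: "\<tau> k \<ge> real k * Tmin" for k
  proof (induction k)
    case (Suc k)
    then show ?case using gap[of k] by (simp add: algebra_simps)
  qed (simp add: \<tau>0)
  obtain n :: nat where "t / Tmin < real n" using reals_Archimedean2 by blast
  then have "t < \<tau> n" using \<tau>_ge[of n] Tmin by (simp add: field_simps)
  then obtain k where k: "\<tau> k \<le> t" "t < \<tau> (Suc k)"
    using ex_least_nat_less[of "\<lambda>k. t < \<tau> k"] \<tau>0 t by force
  define t' where "t' = max (\<tau> k) (t - h)"
  show ?thesis
  proof
    show "t - h \<le> t'" "t' \<le> t" using k h by (auto simp: t'_def)
    fix s
    assume s: "s \<in> {t'..t' + h}"
    have "s < \<tau> (Suc k)"
      using s k gap[of k] h by (auto simp: t'_def max_def split: if_splits)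
    then have "sig s = sig (\<tau> k)" using s by (intro const) (auto simp: t'_def)
    then show "sig s = sig t" using const[OF k] by simp
  qed
qed

section \<open>The Lyapunov function of the network\<close>

locale switched_consensus =
  fixes a :: "nat \<Rightarrow> 'v::finite \<Rightarrow> 'v \<Rightarrow> real"
    and Q :: nat
    and sig :: "real \<Rightarrow> nat"
    and Tmin T phi :: real
    and A :: "real^'n^'n" and B :: "real^'m^'n" and P :: "real^'n^'n"
    and x :: "real \<Rightarrow> 'v \<Rightarrow> real^'n"
  assumes a_nonneg: "\<And>k i j. k \<in> {1..Q} \<Longrightarrow> a k i j \<ge> 0"
    and a_sym: "\<And>k i j. k \<in> {1..Q} \<Longrightarrow> a k i j = a k j i"
    and Tmin_pos: "Tmin > 0"
    and sw: "switching_signal sig Q Tmin"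
    and T_pos: "T > 0"
    and conn: "\<And>t0. t0 \<ge> 0 \<Longrightarrow> has_spanning_tree (union_edges a sig {t0..<t0 + T})"
    and P_sym: "transpose P = P"
    and P_pd: "pos_def P"
    and lyap: "neg_semidef (transpose A ** P + P ** A)"
    and obs: "observable (transpose B ** P) A"
    and phi_pos: "phi > 0"
    and x_cont: "continuous_on {0..} x"
    and x_ode: "\<And>i t. t \<ge> 0 \<Longrightarrow>
        ((\<lambda>s. x s i) has_vector_derivative
           (A *v x t i + phi *\<^sub>R ((B ** (transpose B ** P)) *v
              (\<Sum>j\<in>UNIV. a (sig t) i j *\<^sub>R (x t j - x t i)))))
         (at t within {t..})"
begin

abbreviation dx :: "real \<Rightarrow> 'v \<Rightarrow> 'v \<Rightarrow> real^'n" where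
  "dx t i j \<equiv> x t i - x t j"

definition K :: "real^'n^'m" where
  "K = transpose B ** P"

definition coupling :: "real \<Rightarrow> 'v \<Rightarrow> real^'n" where
  "coupling t i = (\<Sum>j\<in>UNIV. a (sig t) i j *\<^sub>R (x t j - x t i))"

definition velocity :: "real \<Rightarrow> 'v \<Rightarrow> real^'n" where
  "velocity t i = A *v x t i + phi *\<^sub>R ((B ** K) *v coupling t i)"

definition input_diff :: "real \<Rightarrow> 'v \<Rightarrow> 'v \<Rightarrow> real^'n" where
  "input_diff t i j = phi *\<^sub>R (B *v (K *v (coupling t i - coupling t j)))"

definition lyapunov :: "real \<Rightarrow> real" where
  "lyapunov t = (\<Sum>i\<in>UNIV. \<Sum>j\<in>UNIV. inner (dx t i j) (P *v dx t i j))"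

definition lyapunov_rate :: "real \<Rightarrow> real" where
  "lyapunov_rate t = (\<Sum>i\<in>UNIV. \<Sum>j\<in>UNIV.
     inner (velocity t i - velocity t j) (P *v dx t i j) + inner (dx t i j) (P *v (velocity t i - velocity t j)))"

definition dissipation :: "real \<Rightarrow> real" where
  "dissipation t = (\<Sum>i\<in>UNIV. \<Sum>j\<in>UNIV. a (sig t) i j * (norm (K *v dx t i j))\<^sup>2)"

lemma sig_range: "t \<ge> 0 \<Longrightarrow> sig t \<in> {1..Q}"
  using sw unfolding switching_signal_def by blast

lemma weight_nonneg: "t \<ge> 0 \<Longrightarrow> a (sig t) i j \<ge> 0"
  using a_nonneg sig_range by blast

lemma has_vector_derivative_dx:
  "t \<ge> 0 \<Longrightarrow> ((\<lambda>s. dx s i j) has_vector_derivative velocity t i - velocity t j) (at t within {t..})"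
  using x_ode by (intro has_vector_derivative_diff) (simp_all add: velocity_def coupling_def K_def)

lemma continuous_on_x: "continuous_on {0..} (\<lambda>t. x t i)"
  by (rule continuous_on_product_then_coordinatewise[OF x_cont])

lemma continuous_on_dx: "S \<subseteq> {0..} \<Longrightarrow> continuous_on S (\<lambda>t. dx t i j)"
  by (intro continuous_intros continuous_on_subset[OF continuous_on_x])

lemma continuous_on_matrix_dx: "S \<subseteq> {0..} \<Longrightarrow> continuous_on S (\<lambda>t. M *v dx t i j)"
  by (rule bounded_linear.continuous_on[OF matrix_vector_mul_bounded_linear continuous_on_dx])

lemma velocity_diff: "velocity t i - velocity t j = A *v dx t i j + input_diff t i j"
  by (simp add: velocity_def input_diff_def matrix_vector_mult_diff_distrib
      matrix_vector_mul_assoc[symmetric] scaleR_diff_right algebra_simps)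

lemma K_coupling: "K *v coupling t i = (\<Sum>k\<in>UNIV. a (sig t) i k *\<^sub>R (K *v x t k - K *v x t i))"
  by (simp add: coupling_def vec.sum matrix_vector_mult_scaleR matrix_vector_mult_diff_distrib)

lemma inner_B_P: "inner (B *v z) (P *v d) = inner z (K *v d)"
proof -
  have "inner (B *v z) (P *v d) = inner (z v* transpose B) (P *v d)" by simp
  also have "\<dots> = inner z (transpose B *v (P *v d))" by (rule dot_lmul_matrix)
  finally show ?thesis by (simp add: K_def matrix_vector_mul_assoc)
qed

lemma inner_P_commute: "inner d (P *v y) = inner (P *v d) y"
proof -
  have "inner d (P *v y) = inner (d v* P) y" by (simp add: dot_lmul_matrix)
  also have "d v* P = transpose P *v d" by simp
  finally show ?thesis using P_sym by simp
qed

lemma inner_A_P: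
  "inner (A *v d) (P *v d) + inner d (P *v (A *v d)) = inner d ((transpose A ** P + P ** A) *v d)"
proof -
  have "inner (A *v d) (P *v d) = inner (d v* transpose A) (P *v d)" by simp
  also have "\<dots> = inner d (transpose A *v (P *v d))" by (rule dot_lmul_matrix)
  finally show ?thesis
    by (simp add: matrix_vector_mul_assoc matrix_vector_mult_add_rdistrib inner_add_right)
qed

lemma lyapunov_rate_term:
  "inner (velocity t i - velocity t j) (P *v dx t i j) + inner (dx t i j) (P *v (velocity t i - velocity t j))
   = inner (dx t i j) ((transpose A ** P + P ** A) *v dx t i j)
     + 2 * phi * inner (K *v coupling t i - K *v coupling t j) (K *v x t i - K *v x t j)"
proof -
  define d where "d = dx t i j"
  define z where "z = K *v (coupling t i - coupling t j)"
  have "velocity t i - velocity t j = A *v d + phi *\<^sub>R (B *v z)"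
    by (simp add: velocity_diff input_diff_def d_def z_def)
  then have "inner (velocity t i - velocity t j) (P *v d) + inner d (P *v (velocity t i - velocity t j))
     = (inner (A *v d) (P *v d) + inner d (P *v (A *v d)))
       + phi * (inner (B *v z) (P *v d) + inner d (P *v (B *v z)))"
    by (simp add: inner_add_left inner_add_right matrix_vector_right_distrib matrix_vector_mult_scaleR
        distrib_left)
  also have "inner d (P *v (B *v z)) = inner z (K *v d)"
    by (subst inner_P_commute, subst inner_commute, rule inner_B_P)
  also note inner_B_P
  also note inner_A_P
  finally show ?thesis
    by (simp add: d_def z_def matrix_vector_mult_diff_distrib)
qed

lemma lyapunov_has_derivative:
  "t \<ge> 0 \<Longrightarrow> (lyapunov has_real_derivative lyapunov_rate t) (at t within {t..})"
  unfolding lyapunov_def lyapunov_rate_def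
  by (intro DERIV_sum has_real_derivative_inner has_vector_derivative_dx
      bounded_linear.has_vector_derivative[OF matrix_vector_mul_bounded_linear])

lemma dissipation_nonneg: "t \<ge> 0 \<Longrightarrow> dissipation t \<ge> 0"
  unfolding dissipation_def using weight_nonneg by (intro sum_nonneg mult_nonneg_nonneg) auto

lemma lyapunov_rate_le: "t \<ge> 0 \<Longrightarrow> lyapunov_rate t \<le> - phi * dissipation t"
proof -
  assume t: "t \<ge> 0"
  have sym: "\<And>i k. a (sig t) i k = a (sig t) k i" using a_sym sig_range[OF t] by blast
  have laplacian: "(\<Sum>i\<in>UNIV. \<Sum>j\<in>UNIV. inner (K *v coupling t i - K *v coupling t j) (K *v x t i - K *v x t j))
      = - real CARD('v) * dissipation t"
    using sum_pairs_inner_laplacian[of "a (sig t)" "\<lambda>k. K *v x t k", OF sym]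
    by (simp add: K_coupling dissipation_def matrix_vector_mult_diff_distrib)
  have drift: "(\<Sum>i\<in>UNIV. \<Sum>j\<in>UNIV. inner (dx t i j) ((transpose A ** P + P ** A) *v dx t i j)) \<le> 0"
    using lyap unfolding neg_semidef_def by (intro sum_nonpos) auto
  have "lyapunov_rate t = (\<Sum>i\<in>UNIV. \<Sum>j\<in>UNIV. inner (dx t i j) ((transpose A ** P + P ** A) *v dx t i j))
      + 2 * phi * (\<Sum>i\<in>UNIV. \<Sum>j\<in>UNIV. inner (K *v coupling t i - K *v coupling t j) (K *v x t i - K *v x t j))"
    unfolding lyapunov_rate_def lyapunov_rate_term by (simp add: sum.distrib sum_distrib_left)
  then have "lyapunov_rate t = (\<Sum>i\<in>UNIV. \<Sum>j\<in>UNIV. inner (dx t i j) ((transpose A ** P + P ** A) *v dx t i j))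
      - 2 * phi * real CARD('v) * dissipation t"
    using laplacian by simp
  moreover have "phi * dissipation t \<le> 2 * phi * real CARD('v) * dissipation t"
  proof -
    have "0 < CARD('v)" by simp
    then have "1 \<le> 2 * real CARD('v)" by linarith
    then show ?thesis
      using mult_left_mono[of 1 "2 * real CARD('v)" "phi * dissipation t"] phi_pos dissipation_nonneg[OF t]
      by (simp add: algebra_simps)
  qed
  ultimately show ?thesis using drift by linarith
qed

lemma lyapunov_continuous_on: "S \<subseteq> {0..} \<Longrightarrow> continuous_on S lyapunov"
  unfolding lyapunov_def by (intro continuous_on_sum continuous_on_inner continuous_on_dx continuous_on_matrix_dx)

lemma lyapunov_antimono:
  assumes "0 \<le> t1" "t1 \<le> t2"
  shows "lyapunov t2 \<le> lyapunov t1"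
proof -
  have "lyapunov t2 - lyapunov t1 \<le> 0 * (t2 - t1)"
  proof (rule right_derivative_le_imp_diff_le[OF assms(2) lyapunov_continuous_on])
    show "{t1..t2} \<subseteq> {0..}" using assms by auto
    fix s
    assume "s \<in> {t1..<t2}"
    then have s: "s \<ge> 0" using assms by auto
    show "(lyapunov has_real_derivative lyapunov_rate s) (at s within {s..})"
      by (rule lyapunov_has_derivative[OF s])
    show "lyapunov_rate s \<le> 0"
      using lyapunov_rate_le[OF s] mult_nonneg_nonneg[OF less_imp_le[OF phi_pos] dissipation_nonneg[OF s]]
      by linarith
  qed
  then show ?thesis by simp
qed

lemma lyapunov_term_le: "inner (dx t i j) (P *v dx t i j) \<le> lyapunov t"
proof -
  have nonneg: "0 \<le> inner (dx t i j) (P *v dx t i j)" for i j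
    using pos_def_quadratic_nonneg[OF P_pd] .
  have "inner (dx t i j) (P *v dx t i j) \<le> (\<Sum>j\<in>UNIV. inner (dx t i j) (P *v dx t i j))"
    by (rule member_le_sum) (auto simp: nonneg)
  also have "\<dots> \<le> lyapunov t"
    unfolding lyapunov_def by (rule member_le_sum) (auto intro: sum_nonneg simp: nonneg)
  finally show ?thesis .
qed

lemma lyapunov_nonneg: "lyapunov t \<ge> 0"
  using lyapunov_term_le[of t] pos_def_quadratic_nonneg[OF P_pd] order_trans by blast

lemma dx_bounded: "\<exists>D. \<forall>t\<ge>0. \<forall>i j. norm (dx t i j) \<le> D"
proof -
  obtain c where c: "c > 0" "\<And>v. c * norm v ^ 2 \<le> inner v (P *v v)"
    using pos_def_quadratic_lower_bound[OF P_pd] by blast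
  have "norm (dx t i j) \<le> sqrt (lyapunov 0 / c)" if "t \<ge> 0" for t i j
  proof (rule real_le_rsqrt)
    have "c * norm (dx t i j) ^ 2 \<le> lyapunov 0"
      using c(2) lyapunov_term_le lyapunov_antimono[OF order_refl that] by (meson order_trans)
    then show "norm (dx t i j) ^ 2 \<le> lyapunov 0 / c" using c(1) by (simp add: field_simps)
  qed
  then show ?thesis by blast
qed

subsection \<open>Asymptotic vanishing of the coupling\<close>

definition weights :: "real set" where
  "weights = (\<lambda>(k, i, j). a k i j) ` ({1..Q} \<times> UNIV \<times> UNIV)"

lemma finite_weights: "finite weights"
  by (simp add: weights_def)

lemma weight_in_weights:
  assumes "t \<ge> 0"
  shows "a (sig t) i j \<in> weights"
  unfolding weights_def using sig_range[OF assms] by (intro image_eqI[where x = "(sig t, i, j)"]) auto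

lemma weight_upper_bound: "\<exists>amax>0. \<forall>t\<ge>0. \<forall>i j. a (sig t) i j \<le> amax"
proof (intro exI conjI allI impI)
  show "max 1 (Max weights) > (0::real)" by simp
  fix t :: real and i j
  assume "t \<ge> 0"
  then have "a (sig t) i j \<le> Max weights" by (intro Max_ge finite_weights weight_in_weights)
  then show "a (sig t) i j \<le> max 1 (Max weights)" by simp
qed

lemma weight_positive_lower_bound: "\<exists>amin>0. \<forall>t\<ge>0. \<forall>i j. a (sig t) i j > 0 \<longrightarrow> amin \<le> a (sig t) i j"
proof -
  let ?W = "insert 1 {r \<in> weights. r > 0}"
  have "finite ?W" using finite_weights by simp
  then have "Min ?W > 0" and "\<And>t i j. (t::real) \<ge> 0 \<Longrightarrow> a (sig t) i j > 0 \<Longrightarrow> Min ?W \<le> a (sig t) i j"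
    by (auto simp: weight_in_weights)
  then show ?thesis by blast
qed

lemma norm_K_coupling_le:
  assumes t: "t \<ge> 0" and e: "e \<ge> 0" and amax: "\<And>i j. a (sig t) i j \<le> amax"
    and edge: "\<And>k. a (sig t) i k > 0 \<Longrightarrow> norm (K *v dx t i k) \<le> e"
  shows "norm (K *v coupling t i) \<le> real CARD('v) * amax * e"
proof -
  have summand: "norm (a (sig t) i k *\<^sub>R (K *v x t k - K *v x t i)) \<le> amax * e" for k
  proof (cases "a (sig t) i k > 0")
    case True
    then show ?thesis
      using edge[OF True] amax[of i k] e
      by (simp add: matrix_vector_mult_diff_distrib norm_minus_commute mult_mono)
  next
    case False
    then show ?thesis using weight_nonneg[OF t, of i k] amax[of i k] e by simp
  qed
  have "norm (K *v coupling t i) \<le> (\<Sum>k\<in>UNIV. norm (a (sig t) i k *\<^sub>R (K *v x t k - K *v x t i)))"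
    unfolding K_coupling by (rule norm_sum)
  also have "\<dots> \<le> (\<Sum>k\<in>(UNIV::'v set). amax * e)"
    by (intro sum_mono summand)
  finally show ?thesis by simp
qed

lemma norm_input_diff_le:
  assumes t: "t \<ge> 0" and e: "e \<ge> 0" and amax: "\<And>i j. a (sig t) i j \<le> amax"
    and CB: "CB \<ge> 0" "\<And>z. norm (B *v z) \<le> CB * norm z"
    and edge: "\<And>i j. a (sig t) i j > 0 \<Longrightarrow> norm (K *v dx t i j) \<le> e"
  shows "norm (input_diff t i j) \<le> 2 * phi * CB * real CARD('v) * amax * e"
proof -
  have KU: "norm (K *v coupling t l) \<le> real CARD('v) * amax * e" for l
    by (rule norm_K_coupling_le[OF t e amax edge])
  have "norm (input_diff t i j) = phi * norm (B *v (K *v coupling t i - K *v coupling t j))"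
    using phi_pos by (simp add: input_diff_def matrix_vector_mult_diff_distrib)
  also have "\<dots> \<le> phi * (CB * norm (K *v coupling t i - K *v coupling t j))"
    using CB phi_pos by (intro mult_left_mono) auto
  also have "\<dots> \<le> phi * (CB * (norm (K *v coupling t i) + norm (K *v coupling t j)))"
    using CB phi_pos by (intro mult_left_mono norm_triangle_ineq4) auto
  also have "\<dots> \<le> phi * (CB * (2 * (real CARD('v) * amax * e)))"
    using KU[of i] KU[of j] phi_pos CB by (intro mult_left_mono) auto
  finally show ?thesis by (simp add: algebra_simps)
qed

lemma velocity_diff_bounded: "\<exists>L>0. \<forall>t\<ge>0. \<forall>i j. norm (velocity t i - velocity t j) \<le> L"
proof -
  obtain D where D: "\<And>t i j. t \<ge> 0 \<Longrightarrow> norm (dx t i j) \<le> D" using dx_bounded by blast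
  obtain amax where amax: "\<And>t i j. t \<ge> 0 \<Longrightarrow> a (sig t) i j \<le> amax" using weight_upper_bound by blast
  obtain CA where CA: "CA > 0" "\<And>z. norm (A *v z) \<le> CA * norm z" using matrix_vector_mult_norm_bound by blast
  obtain CB where CB: "CB > 0" "\<And>z. norm (B *v z) \<le> CB * norm z" using matrix_vector_mult_norm_bound by blast
  obtain CK where CK: "CK > 0" "\<And>z. norm (K *v z) \<le> CK * norm z" using matrix_vector_mult_norm_bound by blast
  define L where "L = CA * D + 2 * phi * CB * real CARD('v) * amax * (CK * D)"
  have "norm (velocity t i - velocity t j) \<le> L" if t: "t \<ge> 0" for t i j
  proof -
    have D0: "0 \<le> D" using D[OF t, of i i] by simp
    have K_dx: "norm (K *v dx t i j) \<le> CK * D" for i j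
      using CK(2)[of "dx t i j"] D[OF t, of i j] CK(1) by (meson mult_left_mono less_imp_le order_trans)
    have "norm (A *v dx t i j) \<le> CA * D"
      using CA(2)[of "dx t i j"] D[OF t, of i j] CA(1) by (meson mult_left_mono less_imp_le order_trans)
    moreover have "norm (input_diff t i j) \<le> 2 * phi * CB * real CARD('v) * amax * (CK * D)"
      using CB CK(1) D0 K_dx amax t by (intro norm_input_diff_le) auto
    ultimately show ?thesis
      unfolding velocity_diff L_def using norm_triangle_ineq[of "A *v dx t i j" "input_diff t i j"] by linarith
  qed
  moreover have "L \<le> \<bar>L\<bar> + 1" by simp
  ultimately show ?thesis by (intro exI[of _ "\<bar>L\<bar> + 1"]) (auto intro: order_trans)
qed

lemma matrix_dx_lipschitz:
  fixes M :: "real^'n^'p"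
  obtains C where "C > 0"
    "\<And>t1 t2 i j. 0 \<le> t1 \<Longrightarrow> 0 \<le> t2 \<Longrightarrow> norm (M *v dx t2 i j - M *v dx t1 i j) \<le> C * \<bar>t2 - t1\<bar>"
proof -
  obtain L where L: "L > 0" "\<And>t i j. t \<ge> 0 \<Longrightarrow> norm (velocity t i - velocity t j) \<le> L"
    using velocity_diff_bounded by blast
  obtain CM where CM: "CM > 0" "\<And>z. norm (M *v z) \<le> CM * norm z"
    using matrix_vector_mult_norm_bound by blast
  have forward: "norm (M *v dx u2 i j - M *v dx u1 i j) \<le> CM * L * (u2 - u1)"
    if u: "0 \<le> u1" "u1 \<le> u2" for u1 u2 i j
  proof (rule right_vector_derivative_bound_imp_norm_le[OF u(2)])
    show "continuous_on {u1..u2} (\<lambda>s. M *v dx s i j)" using u by (intro continuous_on_matrix_dx) auto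
    fix s
    assume "s \<in> {u1..<u2}"
    then have s: "s \<ge> 0" using u by auto
    show "((\<lambda>s. M *v dx s i j) has_vector_derivative M *v (velocity s i - velocity s j)) (at s within {s..})"
      by (rule bounded_linear.has_vector_derivative[OF matrix_vector_mul_bounded_linear has_vector_derivative_dx[OF s]])
    show "norm (M *v (velocity s i - velocity s j)) \<le> CM * L"
      using CM(2)[of "velocity s i - velocity s j"] L(2)[OF s] CM(1) by (meson mult_left_mono less_imp_le order_trans)
  qed
  show ?thesis
  proof (rule that)
    show "CM * L > 0" using CM L by simp
    fix t1 t2 :: real and i j
    assume t: "0 \<le> t1" "0 \<le> t2"
    show "norm (M *v dx t2 i j - M *v dx t1 i j) \<le> CM * L * \<bar>t2 - t1\<bar>"
    proof (cases "t1 \<le> t2")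
      case True
      then show ?thesis using forward[OF t(1) True] by simp
    next
      case False
      then show ?thesis using forward[OF t(2), of t1] by (simp add: norm_minus_commute)
    qed
  qed
qed

lemma edge_term_le_dissipation: "t \<ge> 0 \<Longrightarrow> a (sig t) i j * (norm (K *v dx t i j))\<^sup>2 \<le> dissipation t"
proof -
  assume t: "t \<ge> 0"
  have nonneg: "\<And>i j. 0 \<le> a (sig t) i j * (norm (K *v dx t i j))\<^sup>2"
    using weight_nonneg[OF t] by simp
  have "a (sig t) i j * (norm (K *v dx t i j))\<^sup>2 \<le> (\<Sum>j\<in>UNIV. a (sig t) i j * (norm (K *v dx t i j))\<^sup>2)"
    by (rule member_le_sum) (auto simp: nonneg)
  also have "\<dots> \<le> dissipation t"
    unfolding dissipation_def by (rule member_le_sum) (auto intro: sum_nonneg simp: nonneg)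
  finally show ?thesis .
qed

lemma lyapunov_eventually_flat:
  assumes \<eta>: "\<eta> > 0"
  obtains T0 where "T0 \<ge> 0" "\<And>t1 t2. T0 \<le> t1 \<Longrightarrow> t1 \<le> t2 \<Longrightarrow> lyapunov t1 - lyapunov t2 < \<eta>"
proof -
  define Linf where "Linf = Inf (lyapunov ` {0..})"
  have bdd: "bdd_below (lyapunov ` {0..})" using lyapunov_nonneg by (auto intro: bdd_belowI[of _ 0])
  obtain T0 where T0: "T0 \<ge> 0" "lyapunov T0 < Linf + \<eta>"
    using cInf_lessD[of "lyapunov ` {0..}" "Linf + \<eta>"] \<eta> by (auto simp: Linf_def)
  show ?thesis
  proof (rule that[OF T0(1)])
    fix t1 t2
    assume t: "T0 \<le> t1" "t1 \<le> t2"
    have "lyapunov t1 \<le> lyapunov T0" using lyapunov_antimono T0(1) t by blast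
    moreover have "Linf \<le> lyapunov t2" unfolding Linf_def using bdd t T0(1) by (intro cInf_lower) auto
    ultimately show "lyapunov t1 - lyapunov t2 < \<eta>" using T0 by linarith
  qed
qed

lemma lyapunov_drop_of_dissipation:
  assumes \<alpha>: "\<alpha> \<ge> 0" and \<delta>: "\<delta> \<ge> 0"
    and m: "\<And>s. s \<in> {\<alpha>..<\<alpha> + \<delta>} \<Longrightarrow> m \<le> dissipation s"
  shows "phi * m * \<delta> \<le> lyapunov \<alpha> - lyapunov (\<alpha> + \<delta>)"
proof -
  have "lyapunov (\<alpha> + \<delta>) - lyapunov \<alpha> \<le> (- phi * m) * ((\<alpha> + \<delta>) - \<alpha>)"
  proof (rule right_derivative_le_imp_diff_le)
    show "continuous_on {\<alpha>..\<alpha> + \<delta>} lyapunov" using \<alpha> by (intro lyapunov_continuous_on) auto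
    fix s
    assume s: "s \<in> {\<alpha>..<\<alpha> + \<delta>}"
    then have s0: "s \<ge> 0" using \<alpha> by auto
    show "(lyapunov has_real_derivative lyapunov_rate s) (at s within {s..})"
      by (rule lyapunov_has_derivative[OF s0])
    show "lyapunov_rate s \<le> - phi * m"
      using lyapunov_rate_le[OF s0] mult_left_mono[OF m[OF s] less_imp_le[OF phi_pos]] by linarith
  qed (use \<delta> in simp)
  then show ?thesis by simp
qed

text \<open>A large \<open>K *v dx\<close> on an active edge persists over a window on which the edge stays
  active, and the Lyapunov function would drop by a fixed amount there, contradicting its
  convergence.\<close>
lemma eventually_active_edges_K_small:
  assumes \<epsilon>: "\<epsilon> > 0"
  shows "eventually (\<lambda>t. \<forall>i j. a (sig t) i j > 0 \<longrightarrow> norm (K *v dx t i j) \<le> \<epsilon>) at_top"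
proof -
  obtain C where C: "C > 0"
    "\<And>t1 t2 i j. 0 \<le> t1 \<Longrightarrow> 0 \<le> t2 \<Longrightarrow> norm (K *v dx t2 i j - K *v dx t1 i j) \<le> C * \<bar>t2 - t1\<bar>"
    using matrix_dx_lipschitz by blast
  obtain amin where amin: "amin > 0" "\<And>t i j. t \<ge> 0 \<Longrightarrow> a (sig t) i j > 0 \<Longrightarrow> amin \<le> a (sig t) i j"
    using weight_positive_lower_bound by blast
  define \<delta> where "\<delta> = min (\<epsilon> / (2 * C)) (Tmin / 2)"
  have \<delta>: "\<delta> > 0" "\<delta> < Tmin" "C * \<delta> \<le> \<epsilon> / 2"
    using \<epsilon> C Tmin_pos by (auto simp: \<delta>_def min_def field_simps)
  define m where "m = amin * (\<epsilon> / 2)\<^sup>2"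
  have m: "phi * m * \<delta> > 0" using phi_pos amin \<epsilon> \<delta> by (simp add: m_def)
  obtain T0 where T0: "T0 \<ge> 0" "\<And>t1 t2. T0 \<le> t1 \<Longrightarrow> t1 \<le> t2 \<Longrightarrow> lyapunov t1 - lyapunov t2 < phi * m * \<delta>"
    using lyapunov_eventually_flat[OF m] by blast
  have "norm (K *v dx t i j) \<le> \<epsilon>" if t: "t \<ge> T0 + \<delta>" and active: "a (sig t) i j > 0" for t i j
  proof (rule ccontr)
    assume big: "\<not> norm (K *v dx t i j) \<le> \<epsilon>"
    have t0: "t \<ge> 0" using t T0 \<delta> by linarith
    obtain \<alpha> where \<alpha>: "t - \<delta> \<le> \<alpha>" "\<alpha> \<le> t" "\<And>s. s \<in> {\<alpha>..\<alpha> + \<delta>} \<Longrightarrow> sig s = sig t"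
      using switching_signal_dwell_window[OF sw t0 less_imp_le[OF \<delta>(1)] \<delta>(2)] by blast
    have "m \<le> dissipation s" if s: "s \<in> {\<alpha>..<\<alpha> + \<delta>}" for s
    proof -
      have s0: "s \<ge> 0" using s \<alpha>(1) t T0 by auto
      have "norm (K *v dx s i j - K *v dx t i j) \<le> C * \<bar>s - t\<bar>" using C(2)[OF t0 s0] .
      also have "\<dots> \<le> C * \<delta>" using s \<alpha>(1,2) C(1) by (intro mult_left_mono) auto
      finally have "\<epsilon> / 2 \<le> norm (K *v dx s i j)"
        using big \<delta>(3) norm_triangle_ineq3[of "K *v dx t i j" "K *v dx s i j"]
        by (simp add: norm_minus_commute)
      moreover have "amin \<le> a (sig s) i j" using amin(2)[OF t0 active] \<alpha>(3)[of s] s by simp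
      ultimately have "m \<le> a (sig s) i j * (norm (K *v dx s i j))\<^sup>2"
        unfolding m_def using amin(1) \<epsilon> by (intro mult_mono power_mono) auto
      then show ?thesis using edge_term_le_dissipation[OF s0, of i j] by linarith
    qed
    then have "phi * m * \<delta> \<le> lyapunov \<alpha> - lyapunov (\<alpha> + \<delta>)"
      using \<alpha>(1) t T0 \<delta> by (intro lyapunov_drop_of_dissipation) auto
    then show False using T0(2)[of \<alpha> "\<alpha> + \<delta>"] \<alpha>(1) t \<delta> by simp
  qed
  then show ?thesis unfolding eventually_at_top_linorder by blast
qed

lemma eventually_input_diff_small:
  assumes \<epsilon>: "\<epsilon> > 0"
  shows "eventually (\<lambda>t. \<forall>i j. norm (input_diff t i j) \<le> \<epsilon>) at_top"
proof -
  obtain amax where amax: "amax > 0" "\<And>t i j. t \<ge> 0 \<Longrightarrow> a (sig t) i j \<le> amax"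
    using weight_upper_bound by blast
  obtain CB where CB: "CB > 0" "\<And>z. norm (B *v z) \<le> CB * norm z"
    using matrix_vector_mult_norm_bound by blast
  define e where "e = \<epsilon> / (2 * phi * CB * real CARD('v) * amax)"
  have e: "e > 0" "2 * phi * CB * real CARD('v) * amax * e = \<epsilon>"
    using \<epsilon> phi_pos CB amax by (simp_all add: e_def)
  have "eventually (\<lambda>t. t \<ge> 0 \<and> (\<forall>i j. a (sig t) i j > 0 \<longrightarrow> norm (K *v dx t i j) \<le> e)) at_top"
    using eventually_active_edges_K_small[OF e(1)] eventually_ge_at_top[of 0] by (simp add: eventually_conj_iff)
  then show ?thesis
  proof (rule eventually_mono, intro allI)
    fix t i j
    assume "t \<ge> 0 \<and> (\<forall>i j. a (sig t) i j > 0 \<longrightarrow> norm (K *v dx t i j) \<le> e)"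
    then have "norm (input_diff t i j) \<le> 2 * phi * CB * real CARD('v) * amax * e"
      using e(1) CB amax(2) by (intro norm_input_diff_le) auto
    then show "norm (input_diff t i j) \<le> \<epsilon>" using e(2) by simp
  qed
qed

subsection \<open>Observability along persistent edges\<close>

definition obs_block :: "nat \<Rightarrow> real^'n^'m" where
  "obs_block k = K ** matpow A k"

lemma obs_block_Suc: "obs_block (Suc k) *v z = obs_block k *v (A *v z)"
  by (simp add: obs_block_def matrix_vector_mul_assoc matrix_mul_assoc)

definition persistent_edge :: "real \<Rightarrow> 'v \<Rightarrow> 'v \<Rightarrow> real \<Rightarrow> bool" where
  "persistent_edge h i j t \<longleftrightarrow> (\<forall>s\<in>{t..t + h}. a (sig s) i j > 0)"

text \<open>Barbalat-type step: \<open>obs_block (Suc k) *v dx\<close> is the derivative of \<open>obs_block k *v dx\<close>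
  up to the input term, so it cannot stay large while \<open>obs_block k *v dx\<close> is small at both ends
  of a window.\<close>
lemma obs_block_Suc_estimate:
  assumes t: "t \<ge> 0" and \<delta>: "\<delta> \<ge> 0" and "C \<ge> 0"
    and C: "\<And>s. s \<ge> 0 \<Longrightarrow> norm (obs_block (Suc k) *v dx s i j - obs_block (Suc k) *v dx t i j) \<le> C * \<bar>s - t\<bar>"
    and CO: "\<And>z. norm (obs_block k *v z) \<le> CO * norm z" "CO \<ge> 0"
    and input: "\<And>s. s \<in> {t..<t + \<delta>} \<Longrightarrow> norm (input_diff s i j) \<le> \<rho>"
  shows "\<delta> * norm (obs_block (Suc k) *v dx t i j)
    \<le> norm (obs_block k *v dx t i j) + norm (obs_block k *v dx (t + \<delta>) i j) + (C * \<delta> + CO * \<rho>) * \<delta>"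
proof (rule right_vector_derivative_near_imp_norm_le[OF \<delta>])
  show "continuous_on {t..t + \<delta>} (\<lambda>s. obs_block k *v dx s i j)"
    using t by (intro continuous_on_matrix_dx) auto
  fix s
  assume s: "s \<in> {t..<t + \<delta>}"
  then have s0: "s \<ge> 0" using t by auto
  show "((\<lambda>s. obs_block k *v dx s i j) has_vector_derivative obs_block k *v (velocity s i - velocity s j))
      (at s within {s..})"
    by (rule bounded_linear.has_vector_derivative[OF matrix_vector_mul_bounded_linear has_vector_derivative_dx[OF s0]])
  have "obs_block k *v (velocity s i - velocity s j) - obs_block (Suc k) *v dx t i j
      = (obs_block (Suc k) *v dx s i j - obs_block (Suc k) *v dx t i j) + obs_block k *v input_diff s i j"
    by (simp add: velocity_diff obs_block_Suc matrix_vector_right_distrib)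
  also have "norm \<dots> \<le> C * \<delta> + CO * \<rho>"
  proof (rule order_trans[OF norm_triangle_ineq add_mono])
    have "\<bar>s - t\<bar> \<le> \<delta>" using s by auto
    then have "C * \<bar>s - t\<bar> \<le> C * \<delta>" using \<open>C \<ge> 0\<close> by (rule mult_left_mono)
    then show "norm (obs_block (Suc k) *v dx s i j - obs_block (Suc k) *v dx t i j) \<le> C * \<delta>"
      using C[OF s0] by linarith
    show "norm (obs_block k *v input_diff s i j) \<le> CO * \<rho>"
      using CO(1)[of "input_diff s i j"] mult_left_mono[OF input[OF s] CO(2)] by linarith
  qed
  finally show "norm (obs_block k *v (velocity s i - velocity s j) - obs_block (Suc k) *v dx t i j)
      \<le> C * \<delta> + CO * \<rho>" .
qed

lemma eventually_obs_block_small: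
  "h > 0 \<Longrightarrow> \<epsilon> > 0 \<Longrightarrow>
    eventually (\<lambda>t. \<forall>i j. persistent_edge h i j t \<longrightarrow> norm (obs_block k *v dx t i j) \<le> \<epsilon>) at_top"
proof (induction k arbitrary: h \<epsilon>)
  case 0
  show ?case
    using eventually_active_edges_K_small[OF \<open>\<epsilon> > 0\<close>]
    by eventually_elim (use \<open>h > 0\<close> in \<open>auto simp: persistent_edge_def obs_block_def\<close>)
next
  case (Suc k)
  obtain C where C: "C > 0" "\<And>t1 t2 i j. 0 \<le> t1 \<Longrightarrow> 0 \<le> t2 \<Longrightarrow>
      norm (obs_block (Suc k) *v dx t2 i j - obs_block (Suc k) *v dx t1 i j) \<le> C * \<bar>t2 - t1\<bar>"
    using matrix_dx_lipschitz by blast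
  obtain CO where CO: "CO > 0" "\<And>z. norm (obs_block k *v z) \<le> CO * norm z"
    using matrix_vector_mult_norm_bound by blast
  define \<delta> where "\<delta> = min (h / 2) (\<epsilon> / (3 * C))"
  have \<delta>: "\<delta> > 0" "\<delta> \<le> h / 2" "C * \<delta> \<le> \<epsilon> / 3"
    using Suc.prems C(1) by (auto simp: \<delta>_def min_def field_simps)
  define \<eta> where "\<eta> = \<epsilon> * \<delta> / 6"
  have "\<eta> > 0" "\<epsilon> / (3 * CO) > 0" using Suc.prems \<delta> CO(1) by (simp_all add: \<eta>_def)
  from eventually_conj[OF Suc.IH[OF half_gt_zero[OF Suc.prems(1)] this(1)]
      eventually_conj[OF eventually_input_diff_small[OF this(2)] eventually_ge_at_top[of 0]]]
  obtain T where T: "\<And>t. t \<ge> T \<Longrightarrow>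
      (\<forall>i j. persistent_edge (h / 2) i j t \<longrightarrow> norm (obs_block k *v dx t i j) \<le> \<eta>) \<and>
      (\<forall>i j. norm (input_diff t i j) \<le> \<epsilon> / (3 * CO)) \<and> t \<ge> 0"
    unfolding eventually_at_top_linorder by blast
  have "norm (obs_block (Suc k) *v dx t i j) \<le> \<epsilon>" if t: "t \<ge> T" and edge: "persistent_edge h i j t" for t i j
  proof -
    have t0: "t \<ge> 0" using T[OF t] by blast
    have "persistent_edge (h / 2) i j t" "persistent_edge (h / 2) i j (t + \<delta>)"
      using edge \<delta> unfolding persistent_edge_def by auto
    then have ends: "norm (obs_block k *v dx t i j) \<le> \<eta>" "norm (obs_block k *v dx (t + \<delta>) i j) \<le> \<eta>"
      using T[OF t] T[of "t + \<delta>"] t \<delta>(1) by auto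
    have input: "norm (input_diff s i j) \<le> \<epsilon> / (3 * CO)" if "s \<in> {t..<t + \<delta>}" for s
      using T[of s] t that by auto
    have "\<delta> * norm (obs_block (Suc k) *v dx t i j) \<le> \<eta> + \<eta> + (C * \<delta> + CO * (\<epsilon> / (3 * CO))) * \<delta>"
      using obs_block_Suc_estimate[OF t0 less_imp_le[OF \<delta>(1)] less_imp_le[OF C(1)] C(2)[OF t0]
          CO(2) less_imp_le[OF CO(1)] input] ends by linarith
    also have "\<dots> \<le> \<eta> + \<eta> + (\<epsilon> / 3 + \<epsilon> / 3) * \<delta>"
      using \<delta> CO(1) by (intro add_left_mono mult_right_mono) auto
    also have "\<dots> = \<delta> * \<epsilon>" by (simp add: \<eta>_def algebra_simps)
    finally show ?thesis using \<delta>(1) by simp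
  qed
  then show ?case unfolding eventually_at_top_linorder by blast
qed

lemma observability_lower_bound: "\<exists>c>0. \<forall>v. c * norm v \<le> (\<Sum>k<CARD('n). norm (obs_block k *v v))"
proof -
  have "\<exists>c>0. \<forall>v. c * norm v ^ 1 \<le> (\<Sum>k<CARD('n). norm (obs_block k *v v))"
  proof (rule homogeneous_pos_lower_bound)
    show "continuous_on UNIV (\<lambda>v. \<Sum>k<CARD('n). norm (obs_block k *v v))" by (intro continuous_intros)
    fix v :: "real^'n"
    assume v: "v \<noteq> 0"
    have "\<not> (\<forall>k<CARD('n). K *v ((((*v) A) ^^ k) v) = 0)"
      using obs v unfolding observable_def K_def by blast
    then obtain k where "k < CARD('n)" "obs_block k *v v \<noteq> 0"
      by (auto simp: obs_block_def funpow_matrix_vector_mult matrix_vector_mul_assoc)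
    then show "(\<Sum>k<CARD('n). norm (obs_block k *v v)) > 0"
      by (intro sum_pos2[of _ k]) auto
  qed (auto simp: matrix_vector_mult_scaleR sum_distrib_left)
  then show ?thesis by simp
qed

lemma eventually_persistent_edges_small:
  assumes h: "h > 0" and \<epsilon>: "\<epsilon> > 0"
  shows "eventually (\<lambda>t. \<forall>i j. persistent_edge h i j t \<longrightarrow> norm (dx t i j) \<le> \<epsilon>) at_top"
proof -
  obtain c where c: "c > 0" "\<And>v. c * norm v \<le> (\<Sum>k<CARD('n). norm (obs_block k *v v))"
    using observability_lower_bound by blast
  define e where "e = c * \<epsilon> / real CARD('n)"
  have "e > 0" using c \<epsilon> by (simp add: e_def)
  then have "eventually (\<lambda>t. \<forall>k\<in>{..<CARD('n)}. \<forall>i j. persistent_edge h i j t \<longrightarrow> norm (obs_block k *v dx t i j) \<le> e) at_top"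
    using eventually_obs_block_small[OF h] by (simp add: eventually_ball_finite_distrib)
  then show ?thesis
  proof (rule eventually_mono, intro allI impI)
    fix t i j
    assume small: "\<forall>k\<in>{..<CARD('n)}. \<forall>i j. persistent_edge h i j t \<longrightarrow> norm (obs_block k *v dx t i j) \<le> e"
      and edge: "persistent_edge h i j t"
    have "c * norm (dx t i j) \<le> (\<Sum>k<CARD('n). norm (obs_block k *v dx t i j))" by (rule c(2))
    also have "\<dots> \<le> (\<Sum>k<CARD('n). e)" using small edge by (intro sum_mono) auto
    also have "\<dots> = c * \<epsilon>" by (simp add: e_def)
    finally show "norm (dx t i j) \<le> \<epsilon>" using c(1) by simp
  qed
qed

subsection \<open>Connectivity of the union graph\<close>

lemma inner_dx_velocity_le:
  assumes CA: "CA \<ge> 0" "\<And>z. norm (A *v z) \<le> CA * norm z" and input: "norm (input_diff s i j) \<le> e"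
  shows "2 * \<bar>inner (dx s i j) (velocity s i - velocity s j)\<bar> \<le> (2 * CA + 1) * ((norm (dx s i j))\<^sup>2 + e\<^sup>2)"
proof -
  define d where "d = dx s i j"
  have e: "e \<ge> 0" using input norm_ge_zero order_trans by blast
  have "norm (velocity s i - velocity s j) \<le> CA * norm d + e"
    unfolding velocity_diff d_def using CA(2)[of "dx s i j"] input norm_triangle_ineq[of "A *v dx s i j" "input_diff s i j"]
    by linarith
  then have "\<bar>inner d (velocity s i - velocity s j)\<bar> \<le> norm d * (CA * norm d + e)"
    using Cauchy_Schwarz_ineq2[of d] mult_left_mono[of _ _ "norm d"] by (meson norm_ge_zero order_trans)
  also have "2 * (norm d * (CA * norm d + e)) \<le> (2 * CA + 1) * ((norm d)\<^sup>2 + e\<^sup>2)"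
  proof -
    have "2 * (norm d * e) \<le> (norm d)\<^sup>2 + e\<^sup>2" using sum_squares_bound[of "norm d" e] by simp
    moreover have "0 \<le> 2 * CA * e\<^sup>2" using CA(1) by simp
    ultimately show ?thesis by (simp add: power2_eq_square algebra_simps)
  qed
  finally show ?thesis by (simp add: d_def)
qed

lemma dx_growth_bound:
  assumes CA: "CA \<ge> 0" "\<And>z. norm (A *v z) \<le> CA * norm z"
    and Ts: "Ts \<ge> 0" and input: "\<And>s. s \<ge> Ts \<Longrightarrow> norm (input_diff s i j) \<le> e" and e: "e \<ge> 0"
    and t: "t \<ge> Ts" and \<tau>: "\<tau> \<ge> Ts"
  shows "norm (dx \<tau> i j) \<le> exp ((2 * CA + 1) * \<bar>\<tau> - t\<bar>) * (norm (dx t i j) + e)"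
proof -
  define c where "c = 2 * CA + 1"
  define G where "G s = inner (dx s i j) (dx s i j) + e\<^sup>2" for s
  define G' where "G' s = 2 * inner (dx s i j) (velocity s i - velocity s j)" for s
  have der: "(G has_real_derivative G' s) (at s within {s..})" if "s \<ge> Ts" for s
  proof -
    have s: "s \<ge> 0" using Ts that by linarith
    show ?thesis
      using has_real_derivative_inner[OF has_vector_derivative_dx[OF s] has_vector_derivative_dx[OF s]]
      unfolding G_def G'_def by (auto intro!: derivative_eq_intros simp: inner_commute)
  qed
  have cont: "continuous_on {Ts..} G"
    unfolding G_def using Ts by (intro continuous_intros continuous_on_dx) auto
  have rate: "\<bar>G' s\<bar> \<le> c * G s" if "s \<ge> Ts" for s
    using inner_dx_velocity_le[OF CA input[OF that]]
    by (simp add: G_def G'_def c_def power2_norm_eq_inner abs_mult)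
  have growth: "G \<tau> \<le> exp (c * \<bar>\<tau> - t\<bar>) * G t"
    by (rule right_derivative_abs_le_linear_imp_exp_bound[OF cont der rate t \<tau>])
  define E where "E = exp (c * \<bar>\<tau> - t\<bar>)"
  have "1 \<le> E" using CA(1) by (simp add: E_def c_def)
  then have E: "E \<le> E * E" using mult_left_mono[of 1 E E] by simp
  have "(norm (dx \<tau> i j))\<^sup>2 \<le> G \<tau>" unfolding G_def by (simp add: power2_norm_eq_inner)
  also have "\<dots> \<le> E * G t" using growth by (simp add: E_def)
  also have "\<dots> \<le> E * E * G t" using E by (rule mult_right_mono) (simp add: G_def)
  also have "\<dots> \<le> E * E * (norm (dx t i j) + e)\<^sup>2"
  proof (rule mult_left_mono)
    show "G t \<le> (norm (dx t i j) + e)\<^sup>2"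
      unfolding G_def using e by (simp add: power2_norm_eq_inner[symmetric] power2_sum)
  qed (simp add: E_def)
  also have "\<dots> = (E * (norm (dx t i j) + e))\<^sup>2" by (simp only: power2_eq_square mult_ac)
  finally have "norm (dx \<tau> i j) \<le> E * (norm (dx t i j) + e)"
    by (rule power2_le_imp_le) (use e in \<open>simp add: E_def\<close>)
  then show ?thesis by (simp add: E_def c_def)
qed

lemma eventually_union_edges_small:
  assumes \<beta>: "\<beta> > 0"
  shows "eventually (\<lambda>\<tau>. \<forall>(j, i) \<in> union_edges a sig {\<tau>..<\<tau> + T}. norm (dx \<tau> i j) \<le> \<beta>) at_top"
proof -
  obtain CA where CA: "CA > 0" "\<And>z. norm (A *v z) \<le> CA * norm z"
    using matrix_vector_mult_norm_bound by blast
  define E where "E = exp ((2 * CA + 1) * (T + Tmin))"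
  define \<gamma> where "\<gamma> = \<beta> / (2 * E)"
  have \<gamma>: "\<gamma> > 0" "E * (\<gamma> + \<gamma>) = \<beta>" using \<beta> by (simp_all add: \<gamma>_def E_def)
  have half_Tmin: "0 < Tmin / 2" "Tmin / 2 < Tmin" using Tmin_pos by simp_all
  from eventually_conj[OF eventually_persistent_edges_small[OF half_Tmin(1) \<gamma>(1)]
      eventually_conj[OF eventually_input_diff_small[OF \<gamma>(1)] eventually_ge_at_top[of 0]]]
  obtain Ts where Ts: "\<And>t. t \<ge> Ts \<Longrightarrow>
      (\<forall>i j. persistent_edge (Tmin / 2) i j t \<longrightarrow> norm (dx t i j) \<le> \<gamma>) \<and>
      (\<forall>i j. norm (input_diff t i j) \<le> \<gamma>) \<and> t \<ge> 0"
    unfolding eventually_at_top_linorder by blast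
  have "norm (dx \<tau> i j) \<le> \<beta>"
    if \<tau>: "\<tau> \<ge> Ts + Tmin / 2" and edge: "(j, i) \<in> union_edges a sig {\<tau>..<\<tau> + T}" for \<tau> i j
  proof -
    obtain t where t: "\<tau> \<le> t" "t < \<tau> + T" "a (sig t) i j > 0"
      using edge unfolding union_edges_def by auto
    have "t \<ge> 0" using Ts[of t] t(1) \<tau> half_Tmin by auto
    then obtain t' where t': "t - Tmin / 2 \<le> t'" "t' \<le> t" "\<And>s. s \<in> {t'..t' + Tmin / 2} \<Longrightarrow> sig s = sig t"
      using switching_signal_dwell_window[OF sw _ less_imp_le half_Tmin(2)] half_Tmin(1) by blast
    have "persistent_edge (Tmin / 2) i j t'" unfolding persistent_edge_def using t(3) t'(3) by metis
    moreover have t'_Ts: "t' \<ge> Ts" and \<tau>_Ts: "\<tau> \<ge> Ts" using t t'(1,2) \<tau> Tmin_pos by linarith+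
    ultimately have start: "norm (dx t' i j) \<le> \<gamma>" using Ts by blast
    have "norm (dx \<tau> i j) \<le> exp ((2 * CA + 1) * \<bar>\<tau> - t'\<bar>) * (norm (dx t' i j) + \<gamma>)"
      using Ts[of Ts] Ts t'_Ts \<tau>_Ts CA \<gamma>(1) by (intro dx_growth_bound[where Ts = Ts]) auto
    also have "\<dots> \<le> E * (\<gamma> + \<gamma>)"
    proof (rule mult_mono)
      have "\<bar>\<tau> - t'\<bar> \<le> T + Tmin" using t t'(1,2) Tmin_pos by (simp add: abs_le_iff)
      then have "(2 * CA + 1) * \<bar>\<tau> - t'\<bar> \<le> (2 * CA + 1) * (T + Tmin)"
        using CA(1) by (intro mult_left_mono) auto
      then show "exp ((2 * CA + 1) * \<bar>\<tau> - t'\<bar>) \<le> E" by (simp add: E_def)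
    qed (use start \<gamma>(1) in \<open>simp_all add: E_def\<close>)
    finally show ?thesis using \<gamma>(2) by simp
  qed
  then show ?thesis unfolding eventually_at_top_linorder by blast
qed

lemma eventually_dx_small:
  assumes \<epsilon>: "\<epsilon> > 0"
  shows "eventually (\<lambda>\<tau>. \<forall>i j. norm (dx \<tau> i j) \<le> \<epsilon>) at_top"
proof -
  define \<beta> where "\<beta> = \<epsilon> / (2 * real CARD('v \<times> 'v))"
  have \<beta>: "\<beta> > 0" "2 * real CARD('v \<times> 'v) * \<beta> = \<epsilon>" using \<epsilon> by (simp_all add: \<beta>_def)
  have "eventually (\<lambda>\<tau>. \<tau> \<ge> 0 \<and> (\<forall>(j, i) \<in> union_edges a sig {\<tau>..<\<tau> + T}. norm (dx \<tau> i j) \<le> \<beta>)) at_top"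
    using eventually_union_edges_small[OF \<beta>(1)] eventually_ge_at_top[of 0] by (simp add: eventually_conj_iff)
  then show ?thesis
  proof (rule eventually_mono, intro allI)
    fix \<tau> p q
    assume "\<tau> \<ge> 0 \<and> (\<forall>(j, i) \<in> union_edges a sig {\<tau>..<\<tau> + T}. norm (dx \<tau> i j) \<le> \<beta>)"
    then have \<tau>: "\<tau> \<ge> 0"
      and step: "\<And>j i. (j, i) \<in> union_edges a sig {\<tau>..<\<tau> + T} \<Longrightarrow> norm (x \<tau> j - x \<tau> i) \<le> \<beta>"
      by (auto simp: norm_minus_commute)
    show "norm (dx \<tau> p q) \<le> \<epsilon>"
      using has_spanning_tree_norm_diff_le[OF conn[OF \<tau>] step less_imp_le[OF \<beta>(1)]] \<beta>(2) by simp
  qed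
qed

lemma synchronization: "((\<lambda>t. norm (x t i - x t j)) \<longlongrightarrow> 0) at_top"
proof (rule tendstoI)
  fix \<epsilon> :: real
  assume "\<epsilon> > 0"
  then have "eventually (\<lambda>t. \<forall>i j. norm (dx t i j) \<le> \<epsilon> / 2) at_top" by (intro eventually_dx_small) simp
  then show "eventually (\<lambda>t. dist (norm (x t i - x t j)) 0 < \<epsilon>) at_top"
  proof (rule eventually_mono)
    fix t
    assume "\<forall>i j. norm (dx t i j) \<le> \<epsilon> / 2"
    then have "norm (dx t i j) \<le> \<epsilon> / 2" by blast
    then show "dist (norm (x t i - x t j)) 0 < \<epsilon>" using \<open>\<epsilon> > 0\<close> by simp
  qed
qed

end

theorem theorem3:
  fixes a :: "nat \<Rightarrow> 'v::finite \<Rightarrow> 'v \<Rightarrow> real"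
    and Q :: nat
    and sig :: "real \<Rightarrow> nat"
    and Tmin T phi :: real
    and A :: "real^'n^'n" and B :: "real^'m^'n" and P :: "real^'n^'n"
    and x :: "real \<Rightarrow> 'v \<Rightarrow> real^'n"
  assumes N2: "CARD('v) \<ge> 2"
    and Q1: "Q \<ge> 1"
    and a_nonneg: "\<And>k i j. k \<in> {1..Q} \<Longrightarrow> a k i j \<ge> 0"
    and a_sym: "\<And>k i j. k \<in> {1..Q} \<Longrightarrow> a k i j = a k j i"
    and a_diag: "\<And>k i. k \<in> {1..Q} \<Longrightarrow> a k i i = 0"
    and Tmin_pos: "Tmin > 0"
    and sw: "switching_signal sig Q Tmin"
    and T_pos: "T > 0"
    and conn: "\<And>t0. t0 \<ge> 0 \<Longrightarrow> has_spanning_tree (union_edges a sig {t0..<t0 + T})"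
    and stab: "stabilizable A B"
    and P_sym: "transpose P = P"
    and P_pd: "pos_def P"
    and lyap: "neg_semidef (transpose A ** P + P ** A)"
    and obs: "observable (transpose B ** P) A"
    and phi_pos: "phi > 0"
    and x_cont: "continuous_on {0..} x"
    and x_ode: "\<And>i t. t \<ge> 0 \<Longrightarrow>
        ((\<lambda>s. x s i) has_vector_derivative
           (A *v x t i + phi *\<^sub>R ((B ** (transpose B ** P)) *v
              (\<Sum>j\<in>UNIV. a (sig t) i j *\<^sub>R (x t j - x t i)))))
         (at t within {t..})"
  shows "\<forall>i j. ((\<lambda>t. norm (x t i - x t j)) \<longlongrightarrow> 0) at_top"
proof -
  interpret switched_consensus a Q sig Tmin T phi A B P x
    using a_nonneg a_sym Tmin_pos sw T_pos conn P_sym P_pd lyap obs phi_pos x_cont x_ode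
    by unfold_locales blast+
  show ?thesis using synchronization by blast
qed

end
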